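(* The theory $FER_\omega$ of countably many refining equivalence relations with binary splitting has a pair of models of cardinality the continuum which are not isomorphic but are potentially isomorphic.
   Context: $FER_\omega$ is the complete first-order theory, in the language $L_0=\{E_i:i\in\omega\}$ of countably many binary relation symbols, of the structure with universe $2^{\omega}$ in which $E_i(\sigma,\tau)$ holds iff $\sigma|i=\tau|i$. Thus each $E_i$ is an equivalence relation, $E_0$ has a single class, and $E_{i+1}$ refines $E_i$, splitting each $E_i$-class into exactly two classes. Two structures $M$ and $N$ in the same language are potentially isomorphic if there is a notion of forcing $\mathcal P$ satisfying the countable chain condition such that whenever $G$ is $\mathcal P$-generic over the universe $V$, $V[G]\models M\cong N$. *)

theory Defs
  imports Complex_Main "HOL-Library.Countable_Set" "HOL-Library.Equipollence"
begin

section \<open>First-order logic over countably many binary relation symbols\<close>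

record 'a L0_structure =
  universe :: "'a set"
  interp :: "nat \<Rightarrow> 'a \<Rightarrow> 'a \<Rightarrow> bool"

text \<open>First-order logic with equality; variables are named by natural numbers, and
  \<open>Rel i x y\<close> is the atomic formula \<open>E\<^sub>i(x, y)\<close>. The other connectives and the universal
  quantifier are the usual abbreviations.\<close>

datatype L0_formula =
    Eq nat nat
  | Rel nat nat nat
  | Neg L0_formula
  | Conj L0_formula L0_formula
  | Ex nat L0_formula

primrec free_vars :: "L0_formula \<Rightarrow> nat set" where
  "free_vars (Eq x y) = {x, y}"
| "free_vars (Rel i x y) = {x, y}"
| "free_vars (Neg \<phi>) = free_vars \<phi>"
| "free_vars (Conj \<phi> \<psi>) = free_vars \<phi> \<union> free_vars \<psi>"
| "free_vars (Ex x \<phi>) = free_vars \<phi> - {x}"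

primrec sat :: "('a, 'm) L0_structure_scheme \<Rightarrow> (nat \<Rightarrow> 'a) \<Rightarrow> L0_formula \<Rightarrow> bool" where
  "sat M s (Eq x y) \<longleftrightarrow> s x = s y"
| "sat M s (Rel i x y) \<longleftrightarrow> interp M i (s x) (s y)"
| "sat M s (Neg \<phi>) \<longleftrightarrow> \<not> sat M s \<phi>"
| "sat M s (Conj \<phi> \<psi>) \<longleftrightarrow> sat M s \<phi> \<and> sat M s \<psi>"
| "sat M s (Ex x \<phi>) \<longleftrightarrow> (\<exists>a\<in>universe M. sat M (s(x := a)) \<phi>)"

definition sentence :: "L0_formula \<Rightarrow> bool" where
  "sentence \<phi> \<longleftrightarrow> free_vars \<phi> = {}"

definition true_in :: "('a, 'm) L0_structure_scheme \<Rightarrow> L0_formula \<Rightarrow> bool" where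
  "true_in M \<phi> \<longleftrightarrow> (\<forall>s. range s \<subseteq> universe M \<longrightarrow> sat M s \<phi>)"

definition complete_theory :: "('a, 'm) L0_structure_scheme \<Rightarrow> L0_formula set" where
  "complete_theory M = {\<phi>. sentence \<phi> \<and> true_in M \<phi>}"

definition is_model :: "('a, 'm) L0_structure_scheme \<Rightarrow> L0_formula set \<Rightarrow> bool" where
  "is_model M T \<longleftrightarrow> universe M \<noteq> {} \<and> (\<forall>\<phi>\<in>T. true_in M \<phi>)"

definition isomorphic :: "('a, 'm) L0_structure_scheme \<Rightarrow> ('b, 'n) L0_structure_scheme \<Rightarrow> bool" where
  "isomorphic M N \<longleftrightarrow>
     (\<exists>f. bij_betw f (universe M) (universe N) \<and>
          (\<forall>i. \<forall>x\<in>universe M. \<forall>x'\<in>universe M.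
             interp M i x x' \<longleftrightarrow> interp N i (f x) (f x')))"

section \<open>The theory of refining equivalence relations with binary splitting\<close>

text \<open>The restriction of \<open>\<sigma>\<close> to \<open>i = {0, \<dots>, i - 1}\<close> is compared, so \<open>E\<^sub>0\<close> is total.\<close>

definition cantor_structure :: "(nat \<Rightarrow> bool) L0_structure" where
  "cantor_structure =
     \<lparr>universe = UNIV, interp = (\<lambda>i \<sigma> \<tau>. \<forall>k<i. \<sigma> k = \<tau> k)\<rparr>"

definition FER_omega :: "L0_formula set" where
  "FER_omega = complete_theory cantor_structure"

section \<open>Forcing\<close>

text \<open>\<open>le P q p\<close> means that \<open>q\<close> is the stronger condition.\<close>

record 'p forcing =
  conds :: "'p set"
  le :: "'p \<Rightarrow> 'p \<Rightarrow> bool"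

definition notion_of_forcing :: "'p forcing \<Rightarrow> bool" where
  "notion_of_forcing P \<longleftrightarrow>
     conds P \<noteq> {} \<and>
     (\<forall>p\<in>conds P. le P p p) \<and>
     (\<forall>p\<in>conds P. \<forall>q\<in>conds P. \<forall>r\<in>conds P. le P p q \<longrightarrow> le P q r \<longrightarrow> le P p r)"

definition compatible :: "'p forcing \<Rightarrow> 'p \<Rightarrow> 'p \<Rightarrow> bool" where
  "compatible P p q \<longleftrightarrow> (\<exists>r\<in>conds P. le P r p \<and> le P r q)"

definition antichain :: "'p forcing \<Rightarrow> 'p set \<Rightarrow> bool" where
  "antichain P A \<longleftrightarrow>
     A \<subseteq> conds P \<and> (\<forall>p\<in>A. \<forall>q\<in>A. p \<noteq> q \<longrightarrow> \<not> compatible P p q)"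

definition ccc :: "'p forcing \<Rightarrow> bool" where
  "ccc P \<longleftrightarrow> (\<forall>A. antichain P A \<longrightarrow> countable A)"

definition dense_below :: "'p forcing \<Rightarrow> 'p \<Rightarrow> ('p \<Rightarrow> bool) \<Rightarrow> bool" where
  "dense_below P p D \<longleftrightarrow>
     (\<forall>q\<in>conds P. le P q p \<longrightarrow> (\<exists>r\<in>conds P. le P r q \<and> D r))"

text \<open>There is no generic extension \<open>V[G]\<close> inside HOL; truth in \<open>V[G]\<close> for all generic \<open>G\<close> is
  expressed by the forcing relation. A statement of the forcing language is represented by
  the predicate ``\<open>p\<close> forces it'', and each operation below is the clause of the recursive
  definition of the forcing relation for the corresponding logical operation.
  Membership atoms concern names for relations between ground model sets: such a name is a
  set of triples \<open>(x, y, r)\<close>, which stands for the \<open>P\<close>-name consisting of the pairs of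
  the canonical name of \<open>(x, y)\<close> with the condition \<open>r\<close>, so that its value at \<open>G\<close> is
  \<open>{(x, y). \<exists>r\<in>G. (x, y, r) \<in> \<tau>}\<close>. Every relation in \<open>V[G]\<close> between two sets in \<open>V\<close> is the
  value of such a name.\<close>

type_synonym 'p forcing_statement = "'p \<Rightarrow> bool"

type_synonym ('a, 'b, 'p) rel_name = "('a \<times> 'b \<times> 'p) set"

definition rel_names :: "'p forcing \<Rightarrow> 'a set \<Rightarrow> 'b set \<Rightarrow> ('a, 'b, 'p) rel_name set" where
  "rel_names P A B = Pow (A \<times> B \<times> conds P)"

text \<open>Statements that are absolute between \<open>V\<close> and \<open>V[G]\<close>, such as atomic facts about
  structures in \<open>V\<close>:\<close>

definition f_ground :: "bool \<Rightarrow> 'p forcing_statement" where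
  "f_ground b p \<longleftrightarrow> b"

definition f_mem :: "'p forcing \<Rightarrow> 'a \<Rightarrow> 'b \<Rightarrow> ('a, 'b, 'p) rel_name \<Rightarrow> 'p forcing_statement" where
  "f_mem P x y \<tau> p \<longleftrightarrow> dense_below P p (\<lambda>q. \<exists>r. (x, y, r) \<in> \<tau> \<and> le P q r)"

definition f_not :: "'p forcing \<Rightarrow> 'p forcing_statement \<Rightarrow> 'p forcing_statement" where
  "f_not P \<phi> p \<longleftrightarrow> (\<forall>q\<in>conds P. le P q p \<longrightarrow> \<not> \<phi> q)"

definition f_and :: "'p forcing_statement \<Rightarrow> 'p forcing_statement \<Rightarrow> 'p forcing_statement" where
  "f_and \<phi> \<psi> p \<longleftrightarrow> \<phi> p \<and> \<psi> p"

definition f_imp ::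
  "'p forcing \<Rightarrow> 'p forcing_statement \<Rightarrow> 'p forcing_statement \<Rightarrow> 'p forcing_statement" where
  "f_imp P \<phi> \<psi> = f_not P (f_and \<phi> (f_not P \<psi>))"

definition f_iff ::
  "'p forcing \<Rightarrow> 'p forcing_statement \<Rightarrow> 'p forcing_statement \<Rightarrow> 'p forcing_statement" where
  "f_iff P \<phi> \<psi> = f_and (f_imp P \<phi> \<psi>) (f_imp P \<psi> \<phi>)"

text \<open>The quantifiers range over a set of \<open>V\<close> (through canonical names) or over a set of
  names.\<close>

definition f_all :: "'c set \<Rightarrow> ('c \<Rightarrow> 'p forcing_statement) \<Rightarrow> 'p forcing_statement" where
  "f_all A \<phi> p \<longleftrightarrow> (\<forall>x\<in>A. \<phi> x p)"

definition f_ex :: "'p forcing \<Rightarrow> 'c set \<Rightarrow> ('c \<Rightarrow> 'p forcing_statement) \<Rightarrow> 'p forcing_statement" where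
  "f_ex P A \<phi> p \<longleftrightarrow> dense_below P p (\<lambda>q. \<exists>x\<in>A. \<phi> x q)"

text \<open>The statement ``\<open>\<tau>\<close> is (the graph of) an isomorphism from \<open>M\<close> onto \<open>N\<close>'': \<open>\<tau>\<close> is total,
  onto, single-valued, injective, and preserves and reflects every \<open>E\<^sub>i\<close>.\<close>

definition f_isomorphism ::
  "'p forcing \<Rightarrow> 'a L0_structure \<Rightarrow> 'b L0_structure \<Rightarrow> ('a, 'b, 'p) rel_name \<Rightarrow> 'p forcing_statement"
where
  "f_isomorphism P M N \<tau> =
     f_and (f_all (universe M) (\<lambda>x. f_ex P (universe N) (\<lambda>y. f_mem P x y \<tau>)))
    (f_and (f_all (universe N) (\<lambda>y. f_ex P (universe M) (\<lambda>x. f_mem P x y \<tau>)))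
    (f_all (universe M) (\<lambda>x. f_all (universe M) (\<lambda>x'.
     f_all (universe N) (\<lambda>y. f_all (universe N) (\<lambda>y'.
       f_imp P (f_and (f_mem P x y \<tau>) (f_mem P x' y' \<tau>))
         (f_and (f_iff P (f_ground (x = x')) (f_ground (y = y')))
                (f_all (UNIV :: nat set) (\<lambda>i.
                   f_iff P (f_ground (interp M i x x')) (f_ground (interp N i y y')))))))))))"

definition f_isomorphic ::
  "'p forcing \<Rightarrow> 'a L0_structure \<Rightarrow> 'b L0_structure \<Rightarrow> 'p forcing_statement" where
  "f_isomorphic P M N =
     f_ex P (rel_names P (universe M) (universe N)) (\<lambda>\<tau>. f_isomorphism P M N \<tau>)"

text \<open>A statement holds in \<open>V[G]\<close> for every generic \<open>G\<close> iff every condition forces it. HOL cannot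
  quantify existentially over types, so the type from which the conditions are drawn is a
  parameter. For structures of cardinality at most the continuum every type with at least
  continuum many elements yields the same notion: the countable antichains deciding a name
  for the isomorphism generate a complete subalgebra of size at most the continuum of the
  completion of a ccc forcing, and this subalgebra already forces the isomorphism.\<close>

definition potentially_isomorphic ::
  "'p itself \<Rightarrow> 'a L0_structure \<Rightarrow> 'b L0_structure \<Rightarrow> bool" where
  "potentially_isomorphic _ M N \<longleftrightarrow>
     (\<exists>P :: 'p forcing. notion_of_forcing P \<and> ccc P \<and> (\<forall>p\<in>conds P. f_isomorphic P M N p))"

end

theory Submission
  imports Defs "HOL-Analysis.Abstract_Topology_2"
begin

text \<open>Let \<open>M\<close> be the set \<open>2\<^sup>\<omega>\<close> of all branches of the binary tree and let \<open>N\<close> be \<open>2\<^sup>\<omega>\<close> with one branch removed.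

  \<^item> They are elementarily equivalent, because a formula mentions only finitely many of the
    \<open>E\<^sub>i\<close>, and for finitely many symbols the two reducts are isomorphic: the class of the missing
    branch at the deepest relevant level is infinite, so one point can be absorbed there
    (\<open>reduct_isomorphism\<close>).

  \<^item> They are not isomorphic, because \<open>M\<close> is complete (every decreasing sequence of
    \<open>E\<^sub>i\<close>-classes has a common element), whereas in \<open>N\<close> the classes converging to
    the missing branch have empty intersection (\<open>not_isomorphic_punctured\<close>).

  \<^item> In a generic extension both become incomplete dense sets of branches, and a back-and-forth
    argument through finite partial isomorphisms matches them. The chain condition is the only
    obstacle. It is met by letting a condition send a branch \<open>a\<close> only to branches \<open>b\<close> that differ
    from \<open>a\<close> in finitely many places. Such modifications are dense, so partial isomorphisms can
    still be extended (\<open>partial_iso_extension\<close>). There are only countably many possible sets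
    of changed places, and changing the values on a fixed set of places is an automorphism of
    \<open>2\<^sup>\<omega>\<close>. Hence two conditions are compatible whenever they
    use the same sets of changed places over the same finite pattern of initial segments, taken
    long enough to separate the branches in the domain (\<open>partial_iso_union\<close>), and there are only countably many such patterns.\<close>

section \<open>Agreement of branches up to a level\<close>

definition agree :: "nat \<Rightarrow> (nat \<Rightarrow> bool) \<Rightarrow> (nat \<Rightarrow> bool) \<Rightarrow> bool" where
  "agree i \<sigma> \<tau> \<longleftrightarrow> (\<forall>k<i. \<sigma> k = \<tau> k)"

lemma agree_refl [simp]: "agree i \<sigma> \<sigma>"
  by (simp add: agree_def)

lemma agree_commute: "agree i \<sigma> \<tau> \<longleftrightarrow> agree i \<tau> \<sigma>"
  by (auto simp: agree_def)

lemma agree_sym: "agree i \<sigma> \<tau> \<Longrightarrow> agree i \<tau> \<sigma>"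
  by (simp add: agree_def)

lemma agree_trans: "agree i \<rho> \<sigma> \<Longrightarrow> agree i \<sigma> \<tau> \<Longrightarrow> agree i \<rho> \<tau>"
  by (simp add: agree_def)

lemma agree_cong:
  "agree i \<sigma> \<sigma>' \<Longrightarrow> agree i \<tau> \<tau>' \<Longrightarrow> agree i \<sigma>' \<tau>' \<longleftrightarrow> agree i \<sigma> \<tau>"
  by (auto simp: agree_def)

lemma agree_mono: "agree j \<sigma> \<tau> \<Longrightarrow> i \<le> j \<Longrightarrow> agree i \<sigma> \<tau>"
  by (simp add: agree_def)

lemma not_agree_mono: "\<not> agree i \<sigma> \<tau> \<Longrightarrow> i \<le> j \<Longrightarrow> \<not> agree j \<sigma> \<tau>"
  using agree_mono by blast

lemma agree_Suc: "agree (Suc i) \<sigma> \<tau> \<longleftrightarrow> agree i \<sigma> \<tau> \<and> \<sigma> i = \<tau> i"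
  by (auto simp: agree_def less_Suc_eq)

lemma eq_iff_agree: "\<sigma> = \<tau> \<longleftrightarrow> (\<forall>i. agree i \<sigma> \<tau>)"
  by (auto simp: agree_def)

lemma agree_fun_upd: "i \<le> m \<Longrightarrow> agree i (\<sigma>(m := v)) \<tau> \<longleftrightarrow> agree i \<sigma> \<tau>"
  by (auto simp: agree_def)

lemma infinite_agree_class: "infinite {\<tau>. agree n \<sigma> \<tau>}"
proof
  let ?f = "\<lambda>k. \<sigma>(n + k := \<not> \<sigma> (n + k))"
  assume "finite {\<tau>. agree n \<sigma> \<tau>}"
  moreover have "range ?f \<subseteq> {\<tau>. agree n \<sigma> \<tau>}"
    by (auto simp: agree_def)
  ultimately have "finite (range ?f)"
    by (rule rev_finite_subset)
  moreover have "inj ?f"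
  proof (rule injI)
    fix k l assume "?f k = ?f l"
    then have "?f k (n + k) = ?f l (n + k)"
      by (rule fun_cong)
    then show "k = l"
      by (simp split: if_splits)
  qed
  ultimately show False
    using finite_imageD by blast
qed

lemma eventually_separated:
  "eventually (\<lambda>m. agree m \<sigma> \<tau> \<longrightarrow> \<sigma> = \<tau>) sequentially"
proof (cases "\<sigma> = \<tau>")
  case False
  then obtain i where "\<not> agree i \<sigma> \<tau>"
    by (auto simp: eq_iff_agree)
  then have "\<not> agree m \<sigma> \<tau>" if "m \<ge> i" for m
    using that by (rule not_agree_mono)
  then show ?thesis
    unfolding eventually_sequentially by blast
qed simp

lemma finite_set_separated:
  assumes "finite A"
  obtains m where "\<forall>\<sigma>\<in>A. \<forall>\<tau>\<in>A. agree m \<sigma> \<tau> \<longrightarrow> \<sigma> = \<tau>"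
proof -
  have "eventually (\<lambda>m. \<forall>\<sigma>\<in>A. \<forall>\<tau>\<in>A. agree m \<sigma> \<tau> \<longrightarrow> \<sigma> = \<tau>) sequentially"
    using assms by (intro eventually_ball_finite ballI eventually_separated)
  then obtain m where "\<forall>\<sigma>\<in>A. \<forall>\<tau>\<in>A. agree m \<sigma> \<tau> \<longrightarrow> \<sigma> = \<tau>"
    unfolding eventually_sequentially by blast
  then show thesis
    by (rule that)
qed

section \<open>The two models\<close>

definition missing_branch :: "nat \<Rightarrow> bool" where
  "missing_branch = (\<lambda>_. False)"

definition punctured_cantor :: "(nat \<Rightarrow> bool) L0_structure" where
  "punctured_cantor = \<lparr>universe = UNIV - {missing_branch}, interp = agree\<rparr>"

lemma cantor_simps [simp]: "universe cantor_structure = UNIV" "interp cantor_structure = agree"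
  by (auto simp: cantor_structure_def agree_def fun_eq_iff)

lemma punctured_simps [simp]:
  "universe punctured_cantor = UNIV - {missing_branch}" "interp punctured_cantor = agree"
  by (auto simp: punctured_cantor_def)

subsection \<open>Elementary equivalence\<close>

primrec rel_symbols :: "L0_formula \<Rightarrow> nat set" where
  "rel_symbols (Eq x y) = {}"
| "rel_symbols (Rel i x y) = {i}"
| "rel_symbols (Neg \<phi>) = rel_symbols \<phi>"
| "rel_symbols (Conj \<phi> \<psi>) = rel_symbols \<phi> \<union> rel_symbols \<psi>"
| "rel_symbols (Ex x \<phi>) = rel_symbols \<phi>"

lemma finite_rel_symbols: "finite (rel_symbols \<phi>)"
  by (induction \<phi>) auto

lemma sat_reduct_isomorphism:
  assumes g: "bij_betw g (universe M) (universe N)"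
    and "\<And>i x y. i \<in> rel_symbols \<phi> \<Longrightarrow> x \<in> universe M \<Longrightarrow> y \<in> universe M \<Longrightarrow>
           interp N i (g x) (g y) \<longleftrightarrow> interp M i x y"
    and "range s \<subseteq> universe M"
  shows "sat N (g \<circ> s) \<phi> \<longleftrightarrow> sat M s \<phi>"
  using assms(2,3)
proof (induction \<phi> arbitrary: s)
  case (Eq x y)
  then have "s x \<in> universe M" "s y \<in> universe M"
    by auto
  then show ?case
    using bij_betw_imp_inj_on[OF g] by (simp add: inj_on_eq_iff)
next
  case (Rel i x y)
  then have "s x \<in> universe M" "s y \<in> universe M"
    by auto
  then show ?case
    using Rel.prems(1) by simp
next
  case (Ex x \<phi>)
  have upd: "sat N ((g \<circ> s)(x := g a)) \<phi> \<longleftrightarrow> sat M (s(x := a)) \<phi>" if "a \<in> universe M" for a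
  proof -
    have "range (s(x := a)) \<subseteq> universe M"
      using that Ex.prems(2) by auto
    then have "sat N (g \<circ> s(x := a)) \<phi> \<longleftrightarrow> sat M (s(x := a)) \<phi>"
      by (intro Ex.IH Ex.prems(1)) simp_all
    then show ?thesis
      by (simp add: fun_upd_comp)
  qed
  have "universe N = g ` universe M"
    using g by (simp add: bij_betw_imp_surj_on)
  then show ?case
    by (simp only: sat.simps bex_simps upd cong: bex_cong)
qed auto

text \<open>The point lost at the missing branch is absorbed inside its infinite \<open>E\<^sub>n\<close>-class,
  whose elements no \<open>E\<^sub>i\<close> with \<open>i \<le> n\<close> can tell apart.\<close>

lemma reduct_isomorphism:
  obtains g where "bij_betw g UNIV (UNIV - {missing_branch})"
    and "\<And>i x y. i \<le> n \<Longrightarrow> agree i (g x) (g y) \<longleftrightarrow> agree i x y"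
proof -
  define A where "A = {\<tau>. agree n missing_branch \<tau>}"
  have "infinite A"
    by (simp add: A_def infinite_agree_class)
  then obtain h where h: "bij_betw h A (A - {missing_branch})"
    by (rule infinite_imp_bij_betw[THEN exE])
  define g where "g x = (if x \<in> A then h x else x)" for x
  have "bij_betw g A (A - {missing_branch}) \<longleftrightarrow> bij_betw h A (A - {missing_branch})"
    by (rule bij_betw_cong) (simp add: g_def)
  with h have "bij_betw g A (A - {missing_branch})"
    by simp
  moreover have "bij_betw g (- A) (- A) \<longleftrightarrow> bij_betw id (- A) (- A)"
    by (rule bij_betw_cong) (simp add: g_def)
  then have "bij_betw g (- A) (- A)"
    by simp
  ultimately have "bij_betw g (A \<union> - A) ((A - {missing_branch}) \<union> - A)"
    by (rule bij_betw_combine) blast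
  moreover have "(A - {missing_branch}) \<union> - A = UNIV - {missing_branch}"
    by (auto simp: A_def)
  ultimately have bij: "bij_betw g UNIV (UNIV - {missing_branch})"
    by simp
  have g: "agree n x (g x)" for x
  proof (cases "x \<in> A")
    case True
    then have "h x \<in> A"
      using h by (auto simp: bij_betw_def)
    with True show ?thesis
      by (auto simp: g_def A_def agree_def)
  qed (simp add: g_def)
  have "agree i (g x) (g y) \<longleftrightarrow> agree i x y" if "i \<le> n" for i x y
    by (rule agree_cong) (rule agree_mono[OF g that])+
  then show thesis
    by (rule that[OF bij])
qed

lemma is_model_cantor: "is_model cantor_structure FER_omega"
  by (simp add: is_model_def FER_omega_def complete_theory_def)

lemma is_model_punctured: "is_model punctured_cantor FER_omega"
  unfolding is_model_def
proof (intro conjI ballI)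
  have "(\<lambda>_. True) \<in> universe punctured_cantor"
    by (simp add: missing_branch_def fun_eq_iff)
  then show "universe punctured_cantor \<noteq> {}"
    by blast
next
  fix \<phi> assume "\<phi> \<in> FER_omega"
  then have true: "sat cantor_structure s \<phi>" for s
    by (simp add: FER_omega_def complete_theory_def true_in_def)
  obtain n where n: "\<And>i. i \<in> rel_symbols \<phi> \<Longrightarrow> i \<le> n"
    using finite_rel_symbols[of \<phi>] by (auto simp: finite_nat_set_iff_bounded_le)
  obtain g where g: "bij_betw g UNIV (UNIV - {missing_branch})"
    and agree: "\<And>i x y. i \<le> n \<Longrightarrow> agree i (g x) (g y) \<longleftrightarrow> agree i x y"
    using reduct_isomorphism[of n] by blast
  show "true_in punctured_cantor \<phi>"
    unfolding true_in_def
  proof (intro allI impI)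
    fix s :: "nat \<Rightarrow> nat \<Rightarrow> bool"
    assume s: "range s \<subseteq> universe punctured_cantor"
    have "g (inv g (s k)) = s k" for k
    proof -
      have "s k \<in> range g"
        using s bij_betw_imp_surj_on[OF g] by auto
      then show ?thesis
        by (rule f_inv_into_f)
    qed
    then have "g \<circ> (inv g \<circ> s) = s"
      by (simp add: comp_def)
    moreover have "sat punctured_cantor (g \<circ> (inv g \<circ> s)) \<phi> \<longleftrightarrow> sat cantor_structure (inv g \<circ> s) \<phi>"
      by (rule sat_reduct_isomorphism) (use g agree n in auto)
    ultimately show "sat punctured_cantor s \<phi>"
      using true by simp
  qed
qed

subsection \<open>Cardinality\<close>

lemma universe_cantor_eqpoll: "universe cantor_structure \<approx> (UNIV :: real set)"
proof -
  have "bij (Collect :: (nat \<Rightarrow> bool) \<Rightarrow> nat set)"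
    by (rule bij_betwI[where g = "\<lambda>A x. x \<in> A"]) auto
  then have "(UNIV :: (nat \<Rightarrow> bool) set) \<approx> (UNIV :: nat set set)"
    unfolding eqpoll_def by blast
  then show ?thesis
    unfolding cantor_simps using nat_sets_eqpoll_reals by (rule eqpoll_trans)
qed

lemma universe_punctured_eqpoll: "universe punctured_cantor \<approx> (UNIV :: real set)"
proof -
  obtain g :: "(nat \<Rightarrow> bool) \<Rightarrow> nat \<Rightarrow> bool" where "bij_betw g UNIV (UNIV - {missing_branch})"
    by (rule reduct_isomorphism)
  then have "universe cantor_structure \<approx> universe punctured_cantor"
    unfolding eqpoll_def cantor_simps punctured_simps by (rule exI[of _ g])
  then have "universe punctured_cantor \<approx> universe cantor_structure"
    by (rule eqpoll_sym)
  then show ?thesis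
    using universe_cantor_eqpoll by (rule eqpoll_trans)
qed

subsection \<open>Non-isomorphism\<close>

text \<open>The preimages of branches converging to the missing one form a Cauchy sequence, which
  converges in the complete model. The image of the limit would be the missing branch.\<close>

lemma not_isomorphic_punctured: "\<not> isomorphic cantor_structure punctured_cantor"
proof
  assume "isomorphic cantor_structure punctured_cantor"
  then obtain f where bij: "bij_betw f UNIV (UNIV - {missing_branch})"
    and iso: "\<And>i x x'. agree i x x' \<longleftrightarrow> agree i (f x) (f x')"
    by (auto simp: isomorphic_def)
  define z where "z i = missing_branch(i := True)" for i
  have z: "agree i (z j) missing_branch" if "i \<le> j" for i j
    using that by (simp add: z_def agree_fun_upd)
  have "\<exists>x. f x = z i" for i
  proof -
    have "z i \<noteq> missing_branch"
      by (simp add: z_def missing_branch_def fun_eq_iff)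
    then have "z i \<in> f ` UNIV"
      using bij_betw_imp_surj_on[OF bij] by blast
    then show ?thesis
      by auto
  qed
  then obtain x where x: "\<And>i. f (x i) = z i"
    by metis
  \<comment> \<open>the limit of the sequence: coordinate \<open>k\<close> no longer changes after \<open>x (Suc k)\<close>\<close>
  define y where "y k = x (Suc k) k" for k
  have "agree i y (x i)" for i
    unfolding agree_def
  proof (intro allI impI)
    fix k assume "k < i"
    then have "agree (Suc k) (z (Suc k)) (z i)"
      using z[of "Suc k" "Suc k"] z[of "Suc k" i] by (auto intro: agree_trans agree_sym)
    then have "agree (Suc k) (x (Suc k)) (x i)"
      using iso[of "Suc k" "x (Suc k)" "x i"] x by simp
    then show "y k = x i k"
      by (simp add: agree_Suc y_def)
  qed
  then have "agree i (f y) (z i)" for i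
    using iso[of i y "x i"] x by simp
  then have "agree i (f y) missing_branch" for i
    by (rule agree_trans[OF _ z[OF order_refl]])
  then have "f y = missing_branch"
    by (simp add: eq_iff_agree)
  then show False
    using bij_betw_imp_surj_on[OF bij] by blast
qed

section \<open>Partial isomorphisms between sets of branches\<close>

definition partial_iso :: "((nat \<Rightarrow> bool) \<times> (nat \<Rightarrow> bool)) set \<Rightarrow> bool" where
  "partial_iso p \<longleftrightarrow>
     (\<forall>a b a' b' i. (a, b) \<in> p \<longrightarrow> (a', b') \<in> p \<longrightarrow> (agree i a a' \<longleftrightarrow> agree i b b'))"

lemma partial_isoI:
  "(\<And>a b a' b' i. (a, b) \<in> p \<Longrightarrow> (a', b') \<in> p \<Longrightarrow> agree i a a' \<longleftrightarrow> agree i b b') \<Longrightarrow> partial_iso p"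
  by (simp add: partial_iso_def)

lemma partial_isoD:
  "partial_iso p \<Longrightarrow> (a, b) \<in> p \<Longrightarrow> (a', b') \<in> p \<Longrightarrow> agree i a a' \<longleftrightarrow> agree i b b'"
  by (simp add: partial_iso_def)

lemma partial_iso_eq_iff:
  "partial_iso p \<Longrightarrow> (a, b) \<in> p \<Longrightarrow> (a', b') \<in> p \<Longrightarrow> a = a' \<longleftrightarrow> b = b'"
  unfolding eq_iff_agree[of a] eq_iff_agree[of b] by (simp add: partial_isoD[of p a b a' b'])

lemma partial_iso_converse:
  assumes "partial_iso p"
  shows "partial_iso (p\<inverse>)"
proof (rule partial_isoI)
  fix a b a' b' i
  assume "(a, b) \<in> p\<inverse>" "(a', b') \<in> p\<inverse>"
  then show "agree i a a' \<longleftrightarrow> agree i b b'"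
    using partial_isoD[OF assms, of b a b' a' i] by simp
qed

lemma partial_iso_insert:
  assumes p: "partial_iso p" and xy: "\<And>a b i. (a, b) \<in> p \<Longrightarrow> agree i x a \<longleftrightarrow> agree i y b"
  shows "partial_iso (insert (x, y) p)"
proof (rule partial_isoI)
  fix a b a' b' i
  assume "(a, b) \<in> insert (x, y) p" "(a', b') \<in> insert (x, y) p"
  then consider "(a, b) = (x, y)" "(a', b') = (x, y)" | "(a, b) = (x, y)" "(a', b') \<in> p"
    | "(a, b) \<in> p" "(a', b') = (x, y)" | "(a, b) \<in> p" "(a', b') \<in> p"
    by (elim insertE) simp_all
  then show "agree i a a' \<longleftrightarrow> agree i b b'"
  proof cases
    case 3
    then show ?thesis
      using xy[of a b i] by (simp add: agree_commute[of i a] agree_commute[of i b])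
  qed (simp_all add: xy partial_isoD[OF p, of a b a' b'])
qed

text \<open>The image of \<open>x\<close> is found one coordinate at a time. Whenever some \<open>a\<^sub>0\<close> in the domain
  still agrees with \<open>x\<close>, the next coordinate must take the same turn relative to \<open>b\<^sub>0\<close>
  as \<open>x\<close> takes relative to \<open>a\<^sub>0\<close>. The choice of \<open>a\<^sub>0\<close> does not matter since \<open>p\<close> is a
  partial isomorphism. Coordinates from \<open>m\<close> on are still those of \<open>x\<close>, so the image
  found after finitely many steps is a finite modification of \<open>x\<close>.\<close>

lemma partial_iso_extension_upto:
  assumes p: "partial_iso p"
  shows "\<exists>y. (\<forall>k\<ge>m. y k = x k) \<and>
             (\<forall>a b i. (a, b) \<in> p \<longrightarrow> i \<le> m \<longrightarrow> (agree i x a \<longleftrightarrow> agree i y b))"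
proof (induction m)
  case 0
  show ?case
    by (rule exI[of _ x]) (auto simp: agree_def)
next
  case (Suc m)
  then obtain y where "\<forall>k\<ge>m. y k = x k"
    and "\<forall>a b i. (a, b) \<in> p \<longrightarrow> i \<le> m \<longrightarrow> (agree i x a \<longleftrightarrow> agree i y b)"
    by (elim exE conjE)
  then have y: "\<And>k. k \<ge> m \<Longrightarrow> y k = x k"
    and yp: "\<And>a b i. (a, b) \<in> p \<Longrightarrow> i \<le> m \<Longrightarrow> agree i x a \<longleftrightarrow> agree i y b"
    by simp_all
  show ?case
  proof (cases "\<exists>a\<^sub>0 b\<^sub>0. (a\<^sub>0, b\<^sub>0) \<in> p \<and> agree m x a\<^sub>0")
    case True
    then obtain a\<^sub>0 b\<^sub>0 where 0: "(a\<^sub>0, b\<^sub>0) \<in> p" "agree m x a\<^sub>0"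
      by (elim exE conjE)
    define y' where "y' = y(m := (b\<^sub>0 m = (x m = a\<^sub>0 m)))"
    have "agree i x a \<longleftrightarrow> agree i y' b" if ab: "(a, b) \<in> p" and i: "i \<le> Suc m" for a b i
    proof (cases "i \<le> m")
      case True
      then show ?thesis
        using yp[OF ab] by (simp add: agree_fun_upd y'_def)
    next
      case False
      then have [simp]: "i = Suc m"
        using i by simp
      have "x m = a m \<longleftrightarrow> y' m = b m" if "agree m x a"
      proof -
        have "agree m a a\<^sub>0"
          by (rule agree_trans[OF agree_sym[OF that] 0(2)])
        then have "a m = a\<^sub>0 m \<longleftrightarrow> b m = b\<^sub>0 m"
          using partial_isoD[OF p ab 0(1), of m] partial_isoD[OF p ab 0(1), of "Suc m"]
          by (simp add: agree_Suc)
        then show ?thesis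
          by (auto simp: y'_def)
      qed
      moreover have "agree m y' b \<longleftrightarrow> agree m x a"
        using yp[OF ab, of m] by (simp add: agree_fun_upd y'_def)
      ultimately show ?thesis
        by (auto simp: agree_Suc)
    qed
    moreover have "\<forall>k\<ge>Suc m. y' k = x k"
      using y by (simp add: y'_def)
    ultimately show ?thesis
      by (intro exI[of _ y']) simp
  next
    case False
    have "agree i x a \<longleftrightarrow> agree i y b" if ab: "(a, b) \<in> p" and i: "i \<le> Suc m" for a b i
    proof (cases "i \<le> m")
      case True
      then show ?thesis
        by (rule yp[OF ab])
    next
      case False
      then have "i = Suc m"
        using i by simp
      moreover have "\<not> agree m x a"
        using \<open>\<nexists>a\<^sub>0 b\<^sub>0. (a\<^sub>0, b\<^sub>0) \<in> p \<and> agree m x a\<^sub>0\<close> ab by blast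
      ultimately show ?thesis
        using yp[OF ab, of m] by (simp add: agree_Suc)
    qed
    then show ?thesis
      using y by (intro exI[of _ y]) simp
  qed
qed

text \<open>Beyond the level at which \<open>x\<close> has left every element of the domain, the image is
  unconstrained. This freedom is used to keep it away from the missing branch.\<close>

lemma partial_iso_extension:
  assumes "finite p" and p: "partial_iso p" and x: "x \<notin> Domain p"
  obtains y where "y \<noteq> missing_branch" "finite {k. x k \<noteq> y k}" "partial_iso (insert (x, y) p)"
proof -
  have "finite (insert x (Domain p))"
    using \<open>finite p\<close> by (simp add: finite_Domain)
  then obtain m where m: "\<forall>\<sigma>\<in>insert x (Domain p). \<forall>\<tau>\<in>insert x (Domain p). agree m \<sigma> \<tau> \<longrightarrow> \<sigma> = \<tau>"
    by (rule finite_set_separated)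
  have sep: "\<not> agree m x a" if "(a, b) \<in> p" for a b
  proof
    assume "agree m x a"
    moreover have "a \<in> Domain p"
      using that by (rule DomainI)
    ultimately have "x = a"
      using m by simp
    with x \<open>a \<in> Domain p\<close> show False
      by simp
  qed
  obtain y where "\<forall>k\<ge>m. y k = x k"
    and "\<forall>a b i. (a, b) \<in> p \<longrightarrow> i \<le> m \<longrightarrow> (agree i x a \<longleftrightarrow> agree i y b)"
    using partial_iso_extension_upto[OF p, of m x] by (elim exE conjE)
  then have y: "\<And>k. k \<ge> m \<Longrightarrow> y k = x k"
    and yp: "\<And>a b i. (a, b) \<in> p \<Longrightarrow> i \<le> m \<Longrightarrow> agree i x a \<longleftrightarrow> agree i y b"
    by simp_all
  let ?y = "y(m := True)"
  have "agree i x a \<longleftrightarrow> agree i ?y b" if ab: "(a, b) \<in> p" for a b i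
  proof (cases "i \<le> m")
    case True
    then show ?thesis
      using yp[OF ab] by (simp add: agree_fun_upd)
  next
    case False
    have "\<not> agree m ?y b"
      using yp[OF ab, of m] sep[OF ab] by (simp add: agree_fun_upd)
    then show ?thesis
      using False sep[OF ab] not_agree_mono[of m _ _ i] by simp
  qed
  then have iso: "partial_iso (insert (x, ?y) p)"
    by (rule partial_iso_insert[OF p])
  have "?y m \<noteq> missing_branch m"
    by (simp add: missing_branch_def)
  then have ne: "?y \<noteq> missing_branch"
    by (rule contrapos_nn) (rule fun_cong)
  have "{k. x k \<noteq> ?y k} \<subseteq> {..m}"
  proof
    fix k assume "k \<in> {k. x k \<noteq> ?y k}"
    then show "k \<in> {..m}"
      using y[of k] by (cases "k \<le> m") auto
  qed
  then have fin: "finite {k. x k \<noteq> ?y k}"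
    by (rule finite_subset) simp
  show thesis
    by (rule that[OF ne fin iso])
qed

section \<open>The notion of forcing\<close>

definition branch_forcing :: "((nat \<Rightarrow> bool) \<times> (nat \<Rightarrow> bool)) set forcing" where
  "branch_forcing =
     \<lparr>conds = {p. finite p \<and> partial_iso p \<and>
                  (\<forall>(a, b)\<in>p. b \<noteq> missing_branch \<and> finite {k. a k \<noteq> b k})},
      le = (\<lambda>q p. p \<subseteq> q)\<rparr>"

lemma conds_iff:
  "p \<in> conds branch_forcing \<longleftrightarrow> finite p \<and> partial_iso p \<and>
     (\<forall>(a, b)\<in>p. b \<noteq> missing_branch \<and> finite {k. a k \<noteq> b k})"
  by (simp add: branch_forcing_def)

lemma le_iff [simp]: "le branch_forcing q p \<longleftrightarrow> p \<subseteq> q"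
  by (simp add: branch_forcing_def)

lemma notion_of_forcing_branch_forcing: "notion_of_forcing branch_forcing"
proof -
  have "{} \<in> conds branch_forcing"
    by (simp add: conds_iff partial_iso_def)
  then show ?thesis
    unfolding notion_of_forcing_def by auto
qed

subsection \<open>The countable chain condition\<close>

text \<open>The initial segment of \<open>b\<close> need not be recorded: it is determined by that of \<open>a\<close>
  and the changed places.\<close>

definition pattern :: "nat \<Rightarrow> ((nat \<Rightarrow> bool) \<times> (nat \<Rightarrow> bool)) set \<Rightarrow> (nat set \<times> nat set) set" where
  "pattern m p = (\<lambda>(a, b). ({k. k < m \<and> a k}, {k. a k \<noteq> b k})) ` p"

text \<open>A pair from \<open>q\<close> has a counterpart in \<open>p\<close> with the same pattern. Seen from any other pair
  of \<open>p\<close>, the two are indistinguishable, since all splitting happens below level \<open>m\<close>.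
  Seen from the counterpart itself, the pair is moved by the same
  automorphism, namely by changing the values on the common set of changed places.\<close>

lemma partial_iso_union:
  assumes p: "partial_iso p" and q: "partial_iso q" and pat: "pattern m p = pattern m q"
    and sep: "\<And>\<sigma> \<tau>. \<sigma> \<in> Domain p \<Longrightarrow> \<tau> \<in> Domain p \<Longrightarrow> agree m \<sigma> \<tau> \<Longrightarrow> \<sigma> = \<tau>"
  shows "partial_iso (p \<union> q)"
proof -
  have cross: "agree i a a' \<longleftrightarrow> agree i b b'"
    if ab: "(a, b) \<in> p" and ab': "(a', b') \<in> q" for a b a' b' i
  proof -
    have "({k. k < m \<and> a' k}, {k. a' k \<noteq> b' k}) \<in> pattern m p"
      unfolding pat unfolding pattern_def by (rule image_eqI[OF _ ab']) simp
    then obtain a1 b1 where ab1: "(a1, b1) \<in> p"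
      and I: "{k. k < m \<and> a' k} = {k. k < m \<and> a1 k}"
      and D: "{k. a' k \<noteq> b' k} = {k. a1 k \<noteq> b1 k}"
      by (auto simp: pattern_def)
    have I': "a1 k = a' k" if "k < m" for k
      using arg_cong[OF I, of "\<lambda>S. k \<in> S"] that by simp
    have D': "a' k = b' k \<longleftrightarrow> a1 k = b1 k" for k
      using arg_cong[OF D, of "\<lambda>S. k \<in> S"] by auto
    have a1: "agree m a1 a'"
      using I' by (simp add: agree_def)
    have b1: "agree m b1 b'"
      unfolding agree_def
    proof (intro allI impI)
      fix k assume "k < m"
      then show "b1 k = b' k"
        using I'[of k] D'[of k] by auto
    qed
    show ?thesis
    proof (cases "a = a1")
      case True
      then have "b = b1"
        using partial_iso_eq_iff[OF p ab ab1] by simp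
      have "a k = a' k \<longleftrightarrow> b k = b' k" for k
        using True \<open>b = b1\<close> D'[of k] by auto
      then show ?thesis
        by (simp add: agree_def)
    next
      case False
      have same: "agree i a a' \<longleftrightarrow> agree i a a1" "agree i b b' \<longleftrightarrow> agree i b b1" if "i \<le> m" for i
        using agree_cong[OF agree_refl agree_mono[OF a1 that]]
          agree_cong[OF agree_refl agree_mono[OF b1 that]] by simp_all
      have na: "\<not> agree m a a1"
        using sep[of a a1] False DomainI[OF ab] DomainI[OF ab1] by auto
      then have nb: "\<not> agree m b b1"
        using partial_isoD[OF p ab ab1] by simp
      show ?thesis
      proof (cases "i \<le> m")
        case True
        then show ?thesis
          using same partial_isoD[OF p ab ab1] by simp
      next
        case False
        have "\<not> agree m a a'" "\<not> agree m b b'"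
          using na nb same[of m] by simp_all
        then show ?thesis
          using False not_agree_mono[of m _ _ i] by simp
      qed
    qed
  qed
  show ?thesis
  proof (rule partial_isoI)
    fix a b a' b' i
    assume "(a, b) \<in> p \<union> q" "(a', b') \<in> p \<union> q"
    then consider "(a, b) \<in> p" "(a', b') \<in> p" | "(a, b) \<in> p" "(a', b') \<in> q"
      | "(a, b) \<in> q" "(a', b') \<in> p" | "(a, b) \<in> q" "(a', b') \<in> q"
      by (elim UnE) simp_all
    then show "agree i a a' \<longleftrightarrow> agree i b b'"
    proof cases
      case 1
      then show ?thesis by (rule partial_isoD[OF p])
    next
      case 2
      then show ?thesis by (rule cross)
    next
      case 3
      then show ?thesis
        using cross[of a' b' a b i] by (simp add: agree_commute[of i a] agree_commute[of i b])
    next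
      case 4
      then show ?thesis by (rule partial_isoD[OF q])
    qed
  qed
qed

lemma ccc_branch_forcing: "ccc branch_forcing"
  unfolding ccc_def
proof (intro allI impI)
  fix A assume A: "antichain branch_forcing A"
  then have conds: "p \<in> conds branch_forcing" if "p \<in> A" for p
    using that by (auto simp: antichain_def)
  have "\<forall>p\<in>A. \<exists>m. \<forall>\<sigma>\<in>Domain p. \<forall>\<tau>\<in>Domain p. agree m \<sigma> \<tau> \<longrightarrow> \<sigma> = \<tau>"
  proof
    fix p assume "p \<in> A"
    then have "finite (Domain p)"
      using conds by (simp add: conds_iff finite_Domain)
    then obtain m where "\<forall>\<sigma>\<in>Domain p. \<forall>\<tau>\<in>Domain p. agree m \<sigma> \<tau> \<longrightarrow> \<sigma> = \<tau>"
      by (rule finite_set_separated)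
    then show "\<exists>m. \<forall>\<sigma>\<in>Domain p. \<forall>\<tau>\<in>Domain p. agree m \<sigma> \<tau> \<longrightarrow> \<sigma> = \<tau>"
      by (rule exI[of _ m])
  qed
  from bchoice[OF this] obtain lev where
    "\<forall>p\<in>A. \<forall>\<sigma>\<in>Domain p. \<forall>\<tau>\<in>Domain p. agree (lev p) \<sigma> \<tau> \<longrightarrow> \<sigma> = \<tau>"
    by (elim exE)
  then have lev: "\<sigma> = \<tau>" if "p \<in> A" "\<sigma> \<in> Domain p" "\<tau> \<in> Domain p" "agree (lev p) \<sigma> \<tau>" for p \<sigma> \<tau>
    using that by simp
  define code where "code p = (lev p, pattern (lev p) p)" for p
  have "inj_on code A"
  proof (rule inj_onI, rule ccontr)
    fix p q assume pq: "p \<in> A" "q \<in> A" "code p = code q" "p \<noteq> q"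
    have pat: "pattern (lev p) p = pattern (lev p) q"
      using pq(3) unfolding code_def prod.inject by (elim conjE) simp
    have "partial_iso p" "partial_iso q"
      using conds[OF pq(1)] conds[OF pq(2)] by (simp_all add: conds_iff)
    then have "partial_iso (p \<union> q)"
      using pat lev[OF pq(1)] by (rule partial_iso_union)
    then have "p \<union> q \<in> conds branch_forcing"
      using conds[OF pq(1)] conds[OF pq(2)] by (simp add: conds_iff ball_Un)
    then have "compatible branch_forcing p q"
      unfolding compatible_def by (rule rev_bexI) simp
    then show False
      using A pq by (simp add: antichain_def)
  qed
  have "countable (code ` A)"
  proof (rule countable_subset)
    let ?F = "Collect finite :: nat set set"
    have "code p \<in> UNIV \<times> {X. finite X \<and> X \<subseteq> ?F \<times> ?F}" if "p \<in> A" for p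
      using conds[OF that] by (auto simp: code_def pattern_def conds_iff)
    then show "code ` A \<subseteq> UNIV \<times> {X. finite X \<and> X \<subseteq> ?F \<times> ?F}"
      by (rule image_subsetI)
    have F: "countable ?F"
      using countable_Collect_finite_subset[of "UNIV :: nat set"] by simp
    show "countable ((UNIV :: nat set) \<times> {X. finite X \<and> X \<subseteq> ?F \<times> ?F})"
      by (rule countable_SIGMA[OF countableI_type countable_Collect_finite_subset])
        (rule countable_SIGMA[OF F F])
  qed
  then show "countable A"
    using \<open>inj_on code A\<close> by (rule countable_image_inj_on)
qed

subsection \<open>The generic isomorphism\<close>

lemma insert_in_conds_iff:
  "insert (x, y) p \<in> conds branch_forcing \<longleftrightarrow>
     finite p \<and> partial_iso (insert (x, y) p) \<and> y \<noteq> missing_branch \<and> finite {k. x k \<noteq> y k} \<and>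
     (\<forall>(a, b)\<in>p. b \<noteq> missing_branch \<and> finite {k. a k \<noteq> b k})"
  by (simp add: conds_iff)

lemma extend_domain:
  assumes p: "p \<in> conds branch_forcing"
  obtains y where "insert (x, y) p \<in> conds branch_forcing"
proof (cases "x \<in> Domain p")
  case True
  then obtain y where "(x, y) \<in> p"
    by (rule DomainE)
  then have "insert (x, y) p = p"
    by (rule insert_absorb)
  then show thesis
    using p by (intro that[of y]) simp
next
  case False
  have "finite p" "partial_iso p"
    using p by (simp_all add: conds_iff)
  then obtain y where "y \<noteq> missing_branch" "finite {k. x k \<noteq> y k}" "partial_iso (insert (x, y) p)"
    using False by (rule partial_iso_extension)
  then have "insert (x, y) p \<in> conds branch_forcing"
    using p unfolding insert_in_conds_iff by (simp add: conds_iff)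
  then show thesis
    by (rule that)
qed

text \<open>The requirements on a condition other than avoiding the missing branch are symmetric,
  so the same extension property applies to the converse relation.\<close>

lemma extend_range:
  assumes p: "p \<in> conds branch_forcing" and y: "y \<noteq> missing_branch"
  obtains x where "insert (x, y) p \<in> conds branch_forcing"
proof (cases "y \<in> Range p")
  case True
  then obtain x where "(x, y) \<in> p"
    by (rule RangeE)
  then have "insert (x, y) p = p"
    by (rule insert_absorb)
  then show thesis
    using p by (intro that[of x]) simp
next
  case False
  have "finite (p\<inverse>)" "partial_iso (p\<inverse>)" "y \<notin> Domain (p\<inverse>)"
    using p False by (simp_all add: conds_iff partial_iso_converse)
  then obtain x where x: "finite {k. y k \<noteq> x k}" "partial_iso (insert (y, x) (p\<inverse>))"
    by (rule partial_iso_extension)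
  have "(insert (y, x) (p\<inverse>))\<inverse> = insert (x, y) p"
    by auto
  then have "partial_iso (insert (x, y) p)"
    using partial_iso_converse[OF x(2)] by simp
  moreover have "{k. x k \<noteq> y k} = {k. y k \<noteq> x k}"
    by auto
  ultimately have "insert (x, y) p \<in> conds branch_forcing"
    using p y x(1) unfolding insert_in_conds_iff by (simp add: conds_iff)
  then show thesis
    by (rule that)
qed

text \<open>This is the name of the union of the generic filter.\<close>

definition generic_union :: "(nat \<Rightarrow> bool, nat \<Rightarrow> bool, ((nat \<Rightarrow> bool) \<times> (nat \<Rightarrow> bool)) set) rel_name"
where
  "generic_union = {(x, y, r). r \<in> conds branch_forcing \<and> (x, y) \<in> r}"

lemma generic_union_in_rel_names:
  "generic_union \<in> rel_names branch_forcing (universe cantor_structure) (universe punctured_cantor)"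
  by (auto simp: rel_names_def generic_union_def conds_iff)

lemma f_mem_generic_unionI:
  assumes "p \<in> conds branch_forcing" "(x, y) \<in> p"
  shows "f_mem branch_forcing x y generic_union p"
  using assms by (auto simp: f_mem_def dense_below_def generic_union_def)

lemma f_mem_generic_unionE:
  assumes "f_mem branch_forcing x y generic_union p" "p \<in> conds branch_forcing"
  obtains r where "r \<in> conds branch_forcing" "p \<subseteq> r" "(x, y) \<in> r"
  using assms by (fastforce simp: f_mem_def dense_below_def generic_union_def)

lemma f_mem_mono:
  "f_mem branch_forcing x y \<tau> p \<Longrightarrow> p \<subseteq> q \<Longrightarrow> f_mem branch_forcing x y \<tau> q"
  by (auto simp: f_mem_def dense_below_def)

lemma f_iff_groundI:
  assumes "b \<longleftrightarrow> c" "p \<in> conds branch_forcing"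
  shows "f_iff branch_forcing (f_ground b) (f_ground c) p"
  using assms by (auto simp: f_iff_def f_imp_def f_not_def f_and_def f_ground_def)

text \<open>Two pairs forced into the generic relation lie together in a single condition, which is a
  partial isomorphism.\<close>

lemma f_isomorphism_generic_union:
  assumes p: "p \<in> conds branch_forcing"
  shows "f_isomorphism branch_forcing cantor_structure punctured_cantor generic_union p"
proof -
  let ?P = branch_forcing
  let ?mem = "\<lambda>x y. f_mem ?P x y generic_union"
  have total: "f_ex ?P (UNIV - {missing_branch}) (\<lambda>y. ?mem x y) p" for x
    unfolding f_ex_def dense_below_def
  proof (intro ballI impI)
    fix q assume "q \<in> conds ?P"
    then obtain y where y: "insert (x, y) q \<in> conds ?P"
      by (rule extend_domain)
    then have "?mem x y (insert (x, y) q)"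
      by (rule f_mem_generic_unionI) simp
    moreover have "y \<in> UNIV - {missing_branch}"
      using y by (simp add: insert_in_conds_iff)
    ultimately have "\<exists>y'\<in>UNIV - {missing_branch}. ?mem x y' (insert (x, y) q)"
      by (rule bexI)
    moreover have "le ?P (insert (x, y) q) q"
      by (simp add: subset_insertI)
    ultimately show "\<exists>r\<in>conds ?P. le ?P r q \<and> (\<exists>y\<in>UNIV - {missing_branch}. ?mem x y r)"
      by (intro rev_bexI[OF y] conjI)
  qed
  have onto: "f_ex ?P UNIV (\<lambda>x. ?mem x y) p" if "y \<noteq> missing_branch" for y
    unfolding f_ex_def dense_below_def
  proof (intro ballI impI)
    fix q assume "q \<in> conds ?P"
    then obtain x where x: "insert (x, y) q \<in> conds ?P"
      using \<open>y \<noteq> missing_branch\<close> by (rule extend_range)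
    then have "?mem x y (insert (x, y) q)"
      by (rule f_mem_generic_unionI) simp
    then have "\<exists>x'\<in>UNIV. ?mem x' y (insert (x, y) q)"
      by (intro bexI[of _ x] UNIV_I)
    moreover have "le ?P (insert (x, y) q) q"
      by (simp add: subset_insertI)
    ultimately show "\<exists>r\<in>conds ?P. le ?P r q \<and> (\<exists>x\<in>UNIV. ?mem x y r)"
      by (intro rev_bexI[OF x] conjI)
  qed
  have preserves: "f_imp ?P (f_and (?mem x y) (?mem x' y'))
      (f_and (f_iff ?P (f_ground (x = x')) (f_ground (y = y')))
             (f_all (UNIV :: nat set) (\<lambda>i. f_iff ?P (f_ground (agree i x x')) (f_ground (agree i y y'))))) p"
    (is "f_imp ?P _ ?concl p") for x y x' y'
  proof -
    have "\<exists>r\<in>conds ?P. q \<subseteq> r \<and> ?concl r"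
      if q: "q \<in> conds ?P" and mem: "?mem x y q" "?mem x' y' q" for q
    proof -
      obtain r where r: "r \<in> conds ?P" "q \<subseteq> r" "(x, y) \<in> r"
        by (rule f_mem_generic_unionE[OF mem(1) q])
      obtain r' where r': "r' \<in> conds ?P" "r \<subseteq> r'" "(x', y') \<in> r'"
        by (rule f_mem_generic_unionE[OF f_mem_mono[OF mem(2) r(2)] r(1)])
      have iso: "partial_iso r'" "(x, y) \<in> r'"
        using r r' by (auto simp: conds_iff)
      have "x = x' \<longleftrightarrow> y = y'" "agree i x x' \<longleftrightarrow> agree i y y'" for i
        by (rule partial_iso_eq_iff[OF iso r'(3)], rule partial_isoD[OF iso r'(3)])
      then have "?concl r'"
        unfolding f_and_def f_all_def by (intro conjI ballI f_iff_groundI r'(1)) simp_all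
      moreover have "q \<subseteq> r'"
        using r(2) r'(2) by (rule subset_trans)
      ultimately show ?thesis
        by (intro rev_bexI[OF r'(1)] conjI)
    qed
    then show ?thesis
      unfolding f_imp_def f_not_def f_and_def[of _ "f_not _ _"] f_and_def[of "?mem x y"] by auto
  qed
  show ?thesis
    unfolding f_isomorphism_def cantor_simps punctured_simps
    using total onto preserves by (auto simp: f_and_def[of "f_all _ _"] f_all_def[of UNIV] f_all_def[of "UNIV - _"])
qed

lemma potentially_isomorphic_punctured:
  "potentially_isomorphic TYPE(((nat \<Rightarrow> bool) \<times> (nat \<Rightarrow> bool)) set)
     cantor_structure punctured_cantor"
  unfolding potentially_isomorphic_def
proof (intro exI conjI ballI)
  fix p assume "p \<in> conds branch_forcing"
  have "f_isomorphism branch_forcing cantor_structure punctured_cantor generic_union q"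
    if "q \<in> conds branch_forcing" for q
    using that by (rule f_isomorphism_generic_union)
  then show "f_isomorphic branch_forcing cantor_structure punctured_cantor p"
    unfolding f_isomorphic_def f_ex_def dense_below_def
    using generic_union_in_rel_names le_iff by blast
qed (rule notion_of_forcing_branch_forcing ccc_branch_forcing)+

section \<open>Nonisomorphic, potentially isomorphic models\<close>

theorem theorem2p3:
  "\<exists>(M :: (nat \<Rightarrow> bool) L0_structure) (N :: (nat \<Rightarrow> bool) L0_structure).
     is_model M FER_omega \<and> is_model N FER_omega \<and>
     universe M \<approx> (UNIV :: real set) \<and> universe N \<approx> (UNIV :: real set) \<and>
     \<not> isomorphic M N \<and>
     potentially_isomorphic TYPE(((nat \<Rightarrow> bool) \<times> (nat \<Rightarrow> bool)) set) M N"
  using is_model_cantor is_model_punctured universe_cantor_eqpoll universe_punctured_eqpoll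
    not_isomorphic_punctured potentially_isomorphic_punctured
  by blast

end
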